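(* Let $F_1,F_2\colon\mathbb C^+\to\mathbb C^+$ be two analytic functions, neither of which is a conformal automorphism of $\mathbb C^+$, satisfying $\lim_{y\to+\infty}\frac{F_j(iy)}{iy}=1$ for $j\in\{1,2\}$, and let $f\colon(\mathbb C^+\cup\mathbb R)\times\mathbb C^+\to\mathbb C^+$ be defined by $$f(z,w)=F_2\big(F_1(w)-w+z\big)-\big(F_1(w)-w\big).$$ Then there exists a unique analytic function $\omega\colon\mathbb C^+\to\mathbb C^+$ such that $f(z,\omega(z))=\omega(z)$ for all $z\in\mathbb C^+$. Moreover, $\lim_{y\to+\infty}\frac{\omega(iy)}{iy}=1$.
   Context: $\mathbb C^+=\{z\in\mathbb C:\Im z>0\}$. Under the hypotheses, $\Im F_j(w)>\Im w$ for all $w\in\mathbb C^+$, so $f$ is well defined with values in $\mathbb C^+$. *)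

theory Defs
  imports "HOL-Complex_Analysis.Complex_Analysis"
begin

definition upper_half_plane :: "complex set" where
  "upper_half_plane = {z. Im z > 0}"

definition conformal_automorphism :: "complex set \<Rightarrow> (complex \<Rightarrow> complex) \<Rightarrow> bool" where
  "conformal_automorphism S F \<longleftrightarrow>
     F analytic_on S \<and> F \<in> S \<rightarrow> S \<and>
     (\<exists>G. G analytic_on S \<and> G \<in> S \<rightarrow> S \<and> (\<forall>z\<in>S. G (F z) = z \<and> F (G z) = z))"

end

theory Submission
  imports Defs
begin

text \<open>
  Put \<open>H\<^sub>j w = F\<^sub>j w - w\<close>. The normalisation at infinity together with Schwarz--Pick against the point
  \<open>\<i>y\<close>, \<open>y \<rightarrow> \<infinity>\<close>, gives \<open>Im H\<^sub>j \<ge> 0\<close> (Julia's inequality), and the open mapping theorem makes this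
  strict because \<open>F\<^sub>j\<close> is not a translation. The equation \<open>f z w = w\<close> becomes the symmetric system
  \<open>u = z + H\<^sub>1 w\<close>, \<open>w = z + H\<^sub>2 u\<close>. At a solution, Schwarz--Pick bounds the product of divided
  differences of \<open>H\<^sub>1\<close> and \<open>H\<^sub>2\<close> by a constant below 1. This yields uniqueness, differentiability
  in \<open>z\<close>, and a bound on solutions over bounded sets of \<open>z\<close> away from the real axis.
  Hence the set of \<open>z\<close> admitting a solution is closed in the half-plane; it is open by Brouwer's
  theorem on a small disc. For \<open>z = \<i>y\<close> with \<open>y\<close> large, \<open>H\<^sub>j = o(y)\<close> on a disc of radius
  \<open>\<delta>y\<close> about \<open>\<i>y\<close>, so Brouwer gives a solution in that disc: the set is nonempty, hence
  everything, and by uniqueness \<open>\<omega>(\<i>y)/\<i>y \<rightarrow> 1\<close>.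
\<close>

section \<open>Schwarz--Pick inequalities in the half-plane\<close>

text \<open>Relates numerator and denominator of the pseudo-hyperbolic distance
  \<open>cmod (p - q) / cmod (p - cnj q)\<close>, so that the conjugate can be eliminated from
  inequalities between such distances.\<close>

lemma cmod_diff_cnj_power2: "cmod (p - cnj q)^2 = cmod (p - q)^2 + 4 * Im p * Im q"
  unfolding cmod_power2 by (simp add: algebra_simps power2_eq_square)

text \<open>Schwarz's lemma for \<open>F\<close> conjugated by Cayley maps: \<open>\<phi>\<close>
  takes the disc to the half-plane with centre going to \<open>a\<close>, and \<open>\<psi>\<close>
  takes \<open>F a\<close> back to the centre. Cleared of denominators and of conjugates, the
  contraction is symmetric in \<open>a\<close> and \<open>b\<close>.\<close>

lemma Schwarz_Pick:
  assumes holF: "F holomorphic_on {z. Im z > 0}" and F: "\<And>z. Im z > 0 \<Longrightarrow> Im (F z) > 0"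
    and a: "Im a > 0" and b: "Im b > 0"
  shows "cmod (F a - F b)^2 * (Im a * Im b) \<le> cmod (a - b)^2 * (Im (F a) * Im (F b))"
proof -
  define \<phi> where "\<phi> = (\<lambda>\<zeta>. (a - cnj a * \<zeta>) / (1 - \<zeta>))"
  define \<psi> where "\<psi> = (\<lambda>v. (v - F a) / (v - cnj (F a)))"
  have ne1: "1 - \<zeta> \<noteq> 0" if "cmod \<zeta> < 1" for \<zeta>
    using that by auto
  have Im_\<phi>: "Im (\<phi> \<zeta>) > 0" if "cmod \<zeta> < 1" for \<zeta>
  proof -
    have "Im ((a - cnj a * \<zeta>) * cnj (1 - \<zeta>)) = Im a * (1 - (cmod \<zeta>)^2)"
      unfolding cmod_power2 by (simp add: algebra_simps power2_eq_square)
    moreover have "(cmod \<zeta>)^2 < 1"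
      using that by (simp add: power_less_one_iff)
    ultimately have "Im ((a - cnj a * \<zeta>) * cnj (1 - \<zeta>)) > 0"
      using a by simp
    then show ?thesis
      unfolding \<phi>_def complex_div_cnj[of _ "1 - \<zeta>"]
      using ne1[OF that] by (simp add: divide_pos_pos flip: of_real_power)
  qed
  have ne2: "v - cnj (F a) \<noteq> 0" if "Im v > 0" for v
    using F[OF a] that by (auto simp: complex_eq_iff)
  have norm_\<psi>: "cmod (\<psi> v) < 1" if "Im v > 0" for v
  proof -
    have "cmod (v - F a)^2 < cmod (v - cnj (F a))^2"
      unfolding cmod_diff_cnj_power2 using F[OF a] that by simp
    then have "cmod (v - F a) < cmod (v - cnj (F a))"
      by (simp add: power2_less_imp_less)
    then show ?thesis
      unfolding \<psi>_def using ne2[OF that] by (simp add: norm_divide)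
  qed
  define G where "G = (\<lambda>\<zeta>. \<psi> (F (\<phi> \<zeta>)))"
  have hol\<phi>: "\<phi> holomorphic_on ball 0 1"
    unfolding \<phi>_def by (intro holomorphic_intros) (auto simp: ne1)
  have "(F \<circ> \<phi>) holomorphic_on ball 0 1"
    by (rule holomorphic_on_compose_gen[OF hol\<phi> holF]) (auto simp: Im_\<phi>)
  then have holG: "G holomorphic_on ball 0 1"
    unfolding G_def \<psi>_def o_def
    by (intro holomorphic_intros ne2 F Im_\<phi>) auto
  have G0: "G 0 = 0"
    by (simp add: G_def \<psi>_def \<phi>_def)
  \<comment> \<open>The preimage of \<open>b\<close> under \<open>\<phi>\<close>; its modulus is the
    pseudo-hyperbolic distance from \<open>a\<close> to \<open>b\<close>.\<close>
  define \<zeta> where "\<zeta> = (b - a) / (b - cnj a)"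
  have neb: "b - cnj a \<noteq> 0"
    using a b by (auto simp: complex_eq_iff)
  have "cmod (b - a)^2 < cmod (b - cnj a)^2"
    unfolding cmod_diff_cnj_power2 using a b by simp
  then have "cmod \<zeta> < 1"
    using neb by (simp add: \<zeta>_def norm_divide power2_less_imp_less)
  have "\<phi> \<zeta> = b"
  proof -
    have "\<zeta> * (b - cnj a) = b - a"
      using neb by (simp add: \<zeta>_def)
    then have "(1 - \<zeta>) * (b - cnj a) = a - cnj a" "(a - cnj a * \<zeta>) * (b - cnj a) = b * (a - cnj a)"
      by algebra+
    then have "1 - \<zeta> = (a - cnj a) / (b - cnj a)" "a - cnj a * \<zeta> = b * (a - cnj a) / (b - cnj a)"
      using neb by (auto simp: nonzero_eq_divide_eq)
    moreover have "a - cnj a \<noteq> 0"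
      using a by (auto simp: complex_eq_iff)
    ultimately show ?thesis
      using neb by (simp add: \<phi>_def)
  qed
  have "cmod (G \<zeta>) \<le> cmod \<zeta>"
    by (rule Schwarz_Lemma(1)[OF holG G0 _ \<open>cmod \<zeta> < 1\<close>]) (auto simp: G_def intro!: norm_\<psi> F Im_\<phi>)
  moreover have "G \<zeta> = (F b - F a) / (F b - cnj (F a))"
    by (simp only: G_def \<open>\<phi> \<zeta> = b\<close> \<psi>_def)
  ultimately have "cmod (F b - F a) / cmod (F b - cnj (F a)) \<le> cmod (b - a) / cmod (b - cnj a)"
    by (simp only: \<zeta>_def norm_divide)
  then have "cmod (F b - F a) * cmod (b - cnj a) \<le> cmod (b - a) * cmod (F b - cnj (F a))"
    using neb ne2[OF F[OF b]] by (simp add: field_simps)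
  then have "(cmod (F b - F a) * cmod (b - cnj a))^2 \<le> (cmod (b - a) * cmod (F b - cnj (F a)))^2"
    by (intro power_mono) auto
  then have "cmod (F b - F a)^2 * (cmod (b - a)^2 + 4 * Im b * Im a)
      \<le> cmod (b - a)^2 * (cmod (F b - F a)^2 + 4 * Im (F b) * Im (F a))"
    by (simp only: power_mult_distrib cmod_diff_cnj_power2)
  \<comment> \<open>The term \<open>cmod (F b - F a)^2 * cmod (b - a)^2\<close> occurs on both sides
    and cancels.\<close>
  then have "cmod (F b - F a)^2 * (Im a * Im b) \<le> cmod (b - a)^2 * (Im (F a) * Im (F b))"
    by argo
  then show ?thesis
    using norm_minus_commute[of "F a" "F b"] norm_minus_commute[of a b] by simp
qed

text \<open>Adding four times the product of the four imaginary parts to both sides of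
  \<open>Schwarz_Pick\<close> replaces each distance by the distance to the reflected point.\<close>

lemma Schwarz_Pick_cnj:
  assumes "F holomorphic_on {z. Im z > 0}" and "\<And>z. Im z > 0 \<Longrightarrow> Im (F z) > 0"
    and "Im a > 0" and "Im b > 0"
  shows "cmod (F a - cnj (F b))^2 * (Im a * Im b) \<le> cmod (a - cnj b)^2 * (Im (F a) * Im (F b))"
  using Schwarz_Pick[OF assms] unfolding cmod_diff_cnj_power2 by (simp add: algebra_simps)

text \<open>The limit of the two-point inequality as the points merge.\<close>

lemma Schwarz_Pick_deriv:
  assumes holF: "F holomorphic_on {z. Im z > 0}" and F: "\<And>z. Im z > 0 \<Longrightarrow> Im (F z) > 0"
    and w: "Im w > 0" and d: "(F has_field_derivative d) (at w)"
  shows "cmod d \<le> Im (F w) / Im w"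
proof -
  have "eventually (\<lambda>x. x \<in> {z. Im z > 0}) (nhds w)"
    using w by (intro eventually_nhds_in_open open_halfspace_Im_gt) auto
  then have *: "eventually (\<lambda>x. Im x > 0 \<and> x \<noteq> w) (at w)"
    by (auto simp: eventually_at_filter elim: eventually_mono)
  have le: "eventually (\<lambda>x. cmod ((F x - F w) / (x - w))^2 \<le> (Im (F x) / Im x) * (Im (F w) / Im w)) (at w)"
    using *
  proof eventually_elim
    case (elim x)
    then have "cmod (F x - F w)^2 * (Im x * Im w) \<le> cmod (x - w)^2 * (Im (F x) * Im (F w))"
      using Schwarz_Pick[OF holF F, of x w] w by simp
    then show ?case
      using elim w by (simp add: norm_divide power_divide field_simps)
  qed
  have "(F \<longlongrightarrow> F w) (at w)"
    using DERIV_isCont[OF d] by (simp add: isCont_def)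
  then have rhs: "((\<lambda>x. (Im (F x) / Im x) * (Im (F w) / Im w)) \<longlongrightarrow> (Im (F w) / Im w) * (Im (F w) / Im w)) (at w)"
    using w by (intro tendsto_intros) auto
  have lhs: "((\<lambda>x. cmod ((F x - F w) / (x - w))^2) \<longlongrightarrow> cmod d^2) (at w)"
    using d unfolding has_field_derivative_iff by (intro tendsto_intros)
  have "cmod d^2 \<le> (Im (F w) / Im w)^2"
    using tendsto_le[OF at_neq_bot rhs lhs le] by (simp add: power2_eq_square)
  then show ?thesis
    by (rule power2_le_imp_le) (use F[OF w] w in simp)
qed

text \<open>A Harnack-type bound: with \<open>K\<close> the quotient on the right, the reflected
  inequality gives \<open>(cmod (F a) - cmod (F b))^2 \<le> K * cmod (F a) * cmod (F b)\<close>;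
  expand and divide by \<open>cmod (F a)\<close>. It spreads smallness from one point to a
  neighbourhood.\<close>

lemma half_plane_growth:
  assumes holF: "F holomorphic_on {z. Im z > 0}" and F: "\<And>z. Im z > 0 \<Longrightarrow> Im (F z) > 0"
    and a: "Im a > 0" and b: "Im b > 0"
  shows "cmod (F a) \<le> cmod (F b) * (2 + cmod (a - cnj b)^2 / (Im a * Im b))"
proof -
  define K where "K = cmod (a - cnj b)^2 / (Im a * Im b)"
  have K: "K \<ge> 0"
    using a b by (simp add: K_def)
  have "cmod (F a - cnj (F b))^2 \<le> K * (Im (F a) * Im (F b))"
    using Schwarz_Pick_cnj[OF holF F a b] a b by (simp add: K_def field_simps)
  also have "\<dots> \<le> K * (cmod (F a) * cmod (F b))"
    using K F[OF a] F[OF b] by (intro mult_left_mono mult_mono) (auto intro: order.trans[OF abs_ge_self abs_Im_le_cmod])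
  finally have 1: "cmod (F a - cnj (F b))^2 \<le> K * (cmod (F a) * cmod (F b))" .
  have "(cmod (F a) - cmod (F b))^2 \<le> cmod (F a - cnj (F b))^2"
    using norm_triangle_ineq3[of "F a" "cnj (F b)"]
    by (metis complex_mod_cnj abs_ge_zero power2_abs power_mono)
  then have "cmod (F a) * cmod (F a) \<le> cmod (F a) * (cmod (F b) * (2 + K))"
    using 1 by (simp add: power2_eq_square algebra_simps) (smt (verit) zero_le_mult_iff norm_ge_zero)
  moreover have "cmod (F a) > 0"
    using F[OF a] by auto
  ultimately show ?thesis
    unfolding K_def by simp
qed

section \<open>Julia's inequality and its strict form\<close>

text \<open>Apply the reflected inequality to \<open>w\<close> and \<open>\<i> * y\<close>, divide
  by \<open>y^3\<close> and let \<open>y\<close> tend to infinity: both squared moduli tend to 1, as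
  does \<open>Im (v y)\<close>.\<close>

lemma half_plane_Julia:
  assumes holF: "F holomorphic_on {z. Im z > 0}" and F: "\<And>z. Im z > 0 \<Longrightarrow> Im (F z) > 0"
    and lim: "((\<lambda>y::real. F (\<i> * of_real y) / (\<i> * of_real y)) \<longlongrightarrow> 1) at_top"
    and w: "Im w > 0"
  shows "Im w \<le> Im (F w)"
proof -
  define v where "v = (\<lambda>y::real. F (\<i> * of_real y) / of_real y)"
  have "((\<lambda>y. \<i> * (F (\<i> * of_real y) / (\<i> * of_real y))) \<longlongrightarrow> \<i> * 1) at_top"
    by (intro tendsto_intros lim)
  then have v: "(v \<longlongrightarrow> \<i>) at_top"
    by (simp add: v_def)
  have inv: "((\<lambda>y::real. c / of_real y) \<longlongrightarrow> 0) at_top" for c :: complex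
    by (intro tendsto_divide_0[OF tendsto_const] filterlim_of_real_at_infinity)
  have le: "eventually (\<lambda>y. cmod (F w / of_real y - cnj (v y))^2 * Im w
      \<le> cmod (w / of_real y + \<i>)^2 * Im (F w) * Im (v y)) at_top"
    using eventually_gt_at_top[of 0]
  proof eventually_elim
    case (elim y)
    have "F w / of_real y - cnj (v y) = (F w - cnj (F (\<i> * of_real y))) / of_real y"
      by (simp add: v_def diff_divide_distrib)
    then have 1: "cmod (F w - cnj (F (\<i> * of_real y))) = cmod (F w / of_real y - cnj (v y)) * y"
      using elim by (simp add: norm_divide)
    have "w / of_real y + \<i> = (w + \<i> * of_real y) / of_real y"
      using elim by (simp add: field_simps)
    then have 2: "cmod (w + \<i> * of_real y) = cmod (w / of_real y + \<i>) * y"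
      using elim by (simp add: norm_divide)
    have 3: "Im (F (\<i> * of_real y)) = Im (v y) * y"
      using elim by (simp add: v_def)
    have "cmod (F w - cnj (F (\<i> * of_real y)))^2 * (Im w * y)
        \<le> cmod (w + \<i> * of_real y)^2 * (Im (F w) * Im (F (\<i> * of_real y)))"
      using Schwarz_Pick_cnj[OF holF F w, of "\<i> * of_real y"] elim by simp
    \<comment> \<open>On each side the squared modulus contributes \<open>y^2\<close> and the
      imaginary parts one more \<open>y\<close>.\<close>
    then have "(cmod (F w / of_real y - cnj (v y))^2 * Im w) * y^3
        \<le> (cmod (w / of_real y + \<i>)^2 * Im (F w) * Im (v y)) * y^3"
      unfolding 1 2 3 power_mult_distrib by (simp only: power2_eq_square power3_eq_cube mult_ac)
    then show ?case
      using elim by (simp only: mult_le_cancel_right) simp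
  qed
  have lhs: "((\<lambda>y. cmod (F w / of_real y - cnj (v y))^2 * Im w) \<longlongrightarrow> cmod (0 - cnj \<i>)^2 * Im w) at_top"
    by (intro tendsto_intros inv v)
  have rhs: "((\<lambda>y. cmod (w / of_real y + \<i>)^2 * Im (F w) * Im (v y)) \<longlongrightarrow> cmod (0 + \<i>)^2 * Im (F w) * Im \<i>) at_top"
    by (intro tendsto_intros inv v)
  show ?thesis
    using tendsto_le[OF trivial_limit_at_top_linorder rhs lhs le] by simp
qed

text \<open>By Julia's inequality \<open>h\<close> has values in the closed half-plane. If it takes
  a real value, openness of its image forces it to be constant, so \<open>F\<close> is a real
  translation and hence an automorphism.\<close>

lemma non_automorphism_Im_less:
  assumes "F analytic_on upper_half_plane" and "F \<in> upper_half_plane \<rightarrow> upper_half_plane"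
    and not_auto: "\<not> conformal_automorphism upper_half_plane F"
    and lim: "((\<lambda>y::real. F (\<i> * of_real y) / (\<i> * of_real y)) \<longlongrightarrow> 1) at_top"
    and w: "Im w > 0"
  shows "Im w < Im (F w)"
proof (rule ccontr)
  have op: "open {z. Im z > 0}" and con: "connected {z. Im z > 0}"
    by (auto simp: open_halfspace_Im_gt intro: convex_connected convex_halfspace_Im_gt)
  have holF: "F holomorphic_on {z. Im z > 0}" and F: "\<And>z. Im z > 0 \<Longrightarrow> Im (F z) > 0"
    using assms(1,2) by (auto simp: upper_half_plane_def analytic_imp_holomorphic)
  have J: "Im z \<le> Im (F z)" if "Im z > 0" for z
    by (rule half_plane_Julia[OF holF F lim that])
  assume "\<not> Im w < Im (F w)"
  with J[OF w] have eq: "Im (F w) = Im w"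
    by simp
  define h where "h = (\<lambda>z. F z - z)"
  have holh: "h holomorphic_on {z. Im z > 0}"
    unfolding h_def by (intro holomorphic_intros holF)
  have "h constant_on {z. Im z > 0}"
  proof (rule ccontr)
    assume "\<not> h constant_on {z. Im z > 0}"
    then have "open (h ` {z. Im z > 0})"
      by (intro open_mapping_thm[OF holh op con op]) auto
    then obtain e where e: "e > 0" "cball (h w) e \<subseteq> h ` {z. Im z > 0}"
      using w open_contains_cball by (metis (mono_tags, lifting) image_eqI mem_Collect_eq)
    \<comment> \<open>Since \<open>h w\<close> is real, this point lies strictly below the real
      axis, yet inside the image of \<open>h\<close>.\<close>
    have "h w - \<i> * of_real e \<in> cball (h w) e"
      using e by (simp add: dist_norm norm_mult)
    then obtain z where "Im z > 0" "h z = h w - \<i> * of_real e"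
      using e by (metis (mono_tags, lifting) imageE in_mono mem_Collect_eq)
    then have "Im (F z) - Im z = Im (F w) - Im w - e"
      unfolding h_def complex_eq_iff by simp
    with J[OF \<open>Im z > 0\<close>] e eq show False
      by simp
  qed
  then obtain c where c: "\<And>z. Im z > 0 \<Longrightarrow> F z - z = c"
    unfolding constant_on_def h_def by auto
  have "Im c = 0"
    using c[OF w] eq by auto
  have "conformal_automorphism upper_half_plane F"
    unfolding conformal_automorphism_def
  proof (intro conjI exI[of _ "\<lambda>z. z - c"] ballI)
    show "(\<lambda>z. z - c) analytic_on upper_half_plane"
      by (intro analytic_intros)
    show "(\<lambda>z. z - c) \<in> upper_half_plane \<rightarrow> upper_half_plane"
      using \<open>Im c = 0\<close> by (auto simp: upper_half_plane_def)
    fix z assume z: "z \<in> upper_half_plane"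
    show "F z - c = z"
      using z c[of z] by (auto simp: upper_half_plane_def algebra_simps)
    show "F (z - c) = z"
      using z c[of "z - c"] \<open>Im c = 0\<close> by (auto simp: upper_half_plane_def algebra_simps)
  qed (use assms in auto)
  with not_auto show False ..
qed

section \<open>The coupled system and its fixed-point map\<close>

text \<open>First-order approximation with error at most \<open>e * cmod (x - w)\<close>. Halving
  the radius makes the estimate available on closed discs, where Brouwer's theorem is
  applied.\<close>

lemma lipschitz_near:
  fixes H :: "complex \<Rightarrow> complex"
  assumes "(H has_field_derivative d) (at w)" "e > 0"
  obtains r where "r > 0" "\<And>x. cmod (x - w) \<le> r \<Longrightarrow> cmod (H x - H w) \<le> (cmod d + e) * cmod (x - w)"
proof -
  obtain r where r: "r > 0" "\<And>x. cmod (x - w) < r \<Longrightarrow> cmod (H x - H w - d * (x - w)) \<le> e * cmod (x - w)"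
    using assms unfolding has_field_derivative_def has_derivative_at_alt by blast
  show thesis
  proof (rule that[of "r / 2"])
    fix x assume "cmod (x - w) \<le> r / 2"
    then have "cmod (H x - H w - d * (x - w)) \<le> e * cmod (x - w)"
      using r by auto
    then have "cmod (H x - H w) \<le> cmod (d * (x - w)) + e * cmod (x - w)"
      by (smt (verit) norm_triangle_sub)
    then show "cmod (H x - H w) \<le> (cmod d + e) * cmod (x - w)"
      by (simp only: norm_mult distrib_right)
  qed (use r in auto)
qed

text \<open>\<open>H1\<close> and \<open>H2\<close> stand for \<open>F1 w - w\<close> and
  \<open>F2 w - w\<close>. The normalisation at infinity enters separately, through the limits in
  \<open>fixed_point_near_i\<close>.\<close>

locale half_plane_pair =
  fixes H1 H2 :: "complex \<Rightarrow> complex"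
  assumes hol1: "H1 holomorphic_on {z. Im z > 0}" and hol2: "H2 holomorphic_on {z. Im z > 0}"
    and pos1: "\<And>z. Im z > 0 \<Longrightarrow> Im (H1 z) > 0" and pos2: "\<And>z. Im z > 0 \<Longrightarrow> Im (H2 z) > 0"
begin

text \<open>This is \<open>f\<close> rewritten: with \<open>u = z + H1 w\<close> one has
  \<open>F2 u - (F1 w - w) = z + H2 u\<close>. Fixed points are thus the solutions of the symmetric
  system in \<open>u\<close> and \<open>w\<close>.\<close>

definition step :: "complex \<Rightarrow> complex \<Rightarrow> complex" where
  "step z w = z + H2 (z + H1 w)"

text \<open>Keeps each solution above its parameter, so that limits of solutions cannot fall onto
  the real axis.\<close>

lemma Im_step: "Im z > 0 \<Longrightarrow> Im w > 0 \<Longrightarrow> Im z < Im (step z w)"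
  using pos1 pos2 by (simp add: step_def add_pos_pos)

lemma isCont_H:
  assumes "Im z > 0" shows "isCont H1 z" "isCont H2 z"
  using assms hol1 hol2 continuous_on_interior[OF holomorphic_on_imp_continuous_on]
  by (auto simp: open_halfspace_Im_gt interior_open)

lemma continuous_on_step:
  assumes "Im z > 0" "S \<subseteq> {z. Im z > 0}"
  shows "continuous_on S (step z)"
proof -
  have "isCont (step z) w" if "w \<in> S" for w
  proof -
    have "Im w > 0" "Im (z + H1 w) > 0"
      using that assms pos1[of w] by auto
    then show ?thesis
      unfolding step_def by (intro continuous_intros isCont_o2[of w "\<lambda>w. z + H1 w" H2] isCont_H)
  qed
  then show ?thesis
    by (simp add: continuous_at_imp_continuous_on)
qed

lemma brouwer_step:
  assumes "Im z > 0" "cball c r \<subseteq> {z. Im z > 0}" "r \<ge> 0" "\<And>w. w \<in> cball c r \<Longrightarrow> step z w \<in> cball c r"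
  obtains w where "w \<in> cball c r" "step z w = w"
  using brouwer[of "cball c r" "step z"] continuous_on_step[OF assms(1,2)] assms(3,4) by auto

section \<open>Stability, uniqueness and boundedness of fixed points\<close>

text \<open>By Schwarz--Pick the divided differences of \<open>H1\<close> at \<open>w, w'\<close> and of \<open>H2\<close> at \<open>u, u'\<close> have
  product of modulus at most \<open>q\<close>, since \<open>u = z + H1 w\<close> and \<open>w = z + H2 u\<close>.\<close>

lemma fixed_point_stability:
  assumes z: "Im z > 0" and z': "Im z' > 0" and w: "Im w > 0" and w': "Im w' > 0"
    and fixed: "step z w = w" and fixed': "step z' w' = w'"
  defines "q \<equiv> sqrt ((Im (H1 w) / Im (z + H1 w)) * ((Im w - Im z) / Im w))"
  shows "q < 1"
    and "cmod (w' - w) * (1 - q) \<le> cmod (z' - z) * (1 + sqrt (Im w * Im w' / (Im z * Im z')))"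
proof -
  define u u' where "u = z + H1 w" and "u' = z' + H1 w'"
  have u: "Im u > 0" "Im (H1 w) < Im u" and u': "Im u' > 0" "Im (H1 w') < Im u'"
    and uz: "Im u > Im z" "Im u' > Im z'"
    using z z' pos1[OF w] pos1[OF w'] by (auto simp: u_def u'_def)
  have wu: "w = z + H2 u" and wu': "w' = z' + H2 u'"
    using fixed fixed' by (auto simp: step_def u_def u'_def)
  have v: "Im (H2 u) = Im w - Im z" and v': "Im (H2 u') = Im w' - Im z'"
    using arg_cong[OF wu, of Im] arg_cong[OF wu', of Im] by auto
  note p = pos1[OF w] pos1[OF w'] pos2[OF u(1)] pos2[OF u'(1)]
  \<comment> \<open>Both ratios are below 1 because \<open>Im u\<close> and \<open>Im w\<close>
    exceed \<open>Im (H1 w)\<close> and \<open>Im (H2 u)\<close> by exactly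
    \<open>Im z\<close>.\<close>
  define P1 P2 where "P1 = Im (H1 w) / Im u" and "P2 = Im (H2 u) / Im w"
  have P: "0 < P1" "P1 < 1" "0 < P2" "P2 < 1"
    using p u w z v by (auto simp: P1_def P2_def)
  have q: "q = sqrt (P1 * P2)"
    unfolding q_def P1_def P2_def v by (simp add: u_def)
  have "P1 * P2 < 1"
    using P by (smt (verit) mult_less_cancel_left2)
  then show q1: "q < 1"
    unfolding q by simp
  define \<alpha> where "\<alpha> = sqrt (Im (H1 w) * Im (H1 w') / (Im w * Im w'))"
  define \<beta> where "\<beta> = sqrt (Im (H2 u) * Im (H2 u') / (Im u * Im u'))"
  have \<alpha>: "cmod (H1 w' - H1 w) \<le> \<alpha> * cmod (w' - w)"
  proof -
    have "cmod (H1 w' - H1 w)^2 \<le> (Im (H1 w) * Im (H1 w') / (Im w * Im w')) * cmod (w' - w)^2"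
      using Schwarz_Pick[OF hol1 pos1 w' w] w w' by (simp add: field_simps)
    then show ?thesis
      unfolding \<alpha>_def by (metis norm_ge_zero real_le_rsqrt real_sqrt_mult real_sqrt_abs abs_of_nonneg)
  qed
  have \<beta>: "cmod (H2 u' - H2 u) \<le> \<beta> * cmod (u' - u)"
  proof -
    have "cmod (H2 u' - H2 u)^2 \<le> (Im (H2 u) * Im (H2 u') / (Im u * Im u')) * cmod (u' - u)^2"
      using Schwarz_Pick[OF hol2 pos2 u'(1) u(1)] u(1) u'(1) by (simp add: field_simps)
    then show ?thesis
      unfolding \<beta>_def by (metis norm_ge_zero real_le_rsqrt real_sqrt_mult real_sqrt_abs abs_of_nonneg)
  qed
  have nn: "\<alpha> \<ge> 0" "\<beta> \<ge> 0"
    using p w w' u u' by (auto simp: \<alpha>_def \<beta>_def)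
  have "\<beta> * \<alpha> \<le> q"
  proof -
    \<comment> \<open>Exchanging denominators pairs \<open>H1\<close> with \<open>u\<close> and
      \<open>H2\<close> with \<open>w\<close>. The primed ratios are at most 1, so the bound
      \<open>q\<close> depends on \<open>z\<close> and \<open>w\<close> alone and is uniform in
      \<open>z'\<close> and \<open>w'\<close>.\<close>
    have "(Im (H2 u) * Im (H2 u') / (Im u * Im u')) * (Im (H1 w) * Im (H1 w') / (Im w * Im w'))
       = (P1 * P2) * ((Im (H1 w') / Im u') * (Im (H2 u') / Im w'))"
      by (simp add: P1_def P2_def field_simps)
    also have "\<dots> \<le> (P1 * P2) * (1 * 1)"
      using P p u' w' v' z' by (intro mult_left_mono mult_mono) auto
    finally show ?thesis
      unfolding \<alpha>_def \<beta>_def q real_sqrt_mult[symmetric] by simp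
  qed
  have "\<beta> \<le> sqrt (Im w * Im w' / (Im z * Im z'))"
    unfolding \<beta>_def using p v v' uz z z' w w'
    by (intro real_sqrt_le_mono frac_le mult_mono) auto
  have w_le: "cmod (w' - w) \<le> cmod (z' - z) + \<beta> * cmod (u' - u)"
  proof -
    have "w' - w = (z' - z) + (H2 u' - H2 u)"
      using wu wu' by simp
    then show ?thesis
      using norm_triangle_ineq[of "z' - z" "H2 u' - H2 u"] \<beta> by simp
  qed
  have u_le: "cmod (u' - u) \<le> cmod (z' - z) + \<alpha> * cmod (w' - w)"
  proof -
    have "u' - u = (z' - z) + (H1 w' - H1 w)"
      by (simp add: u_def u'_def)
    then show ?thesis
      using norm_triangle_ineq[of "z' - z" "H1 w' - H1 w"] \<alpha> by simp
  qed
  have "cmod (w' - w) \<le> cmod (z' - z) * (1 + \<beta>) + (\<beta> * \<alpha>) * cmod (w' - w)"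
    using w_le mult_left_mono[OF u_le nn(2)] by (simp add: algebra_simps)
  also have "\<dots> \<le> cmod (z' - z) * (1 + sqrt (Im w * Im w' / (Im z * Im z'))) + q * cmod (w' - w)"
    using \<open>\<beta> * \<alpha> \<le> q\<close> \<open>\<beta> \<le> _\<close> by (intro add_mono mult_left_mono mult_right_mono) auto
  finally show "cmod (w' - w) * (1 - q) \<le> cmod (z' - z) * (1 + sqrt (Im w * Im w' / (Im z * Im z')))"
    by (simp add: algebra_simps)
qed

text \<open>For \<open>z' = z\<close> the right-hand side of the stability estimate vanishes, while
  \<open>1 - q > 0\<close>.\<close>

lemma fixed_point_unique:
  assumes "Im z > 0" "Im w > 0" "Im w' > 0" "step z w = w" "step z w' = w'"
  shows "w' = w"
  using fixed_point_stability[of z z w w'] assms by (auto simp: mult_le_0_iff)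

text \<open>The stability estimate bounds the distance \<open>A\<close> to the known solution by a
  constant times \<open>1 + sqrt (k * (Im w + A))\<close>, which grows more slowly than
  \<open>A\<close>.\<close>

lemma fixed_points_bounded:
  assumes z: "Im z > 0" and w: "Im w > 0" and fixed: "step z w = w" and r: "r > 0"
  obtains B where "\<And>z' w'. r \<le> Im z' \<Longrightarrow> cmod (z' - z) \<le> R \<Longrightarrow> Im w' > 0 \<Longrightarrow> step z' w' = w' \<Longrightarrow> cmod (w' - w) \<le> B"
proof -
  define q where "q = sqrt ((Im (H1 w) / Im (z + H1 w)) * ((Im w - Im z) / Im w))"
  have q: "q < 1"
    using fixed_point_stability(1)[OF z z w w fixed fixed] by (simp add: q_def)
  \<comment> \<open>The absolute value keeps \<open>c\<close> nonnegative for every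
    \<open>R\<close>; \<open>k\<close> absorbs \<open>Im z'\<close> by means of
    \<open>r \<le> Im z'\<close>.\<close>
  define c k where "c = \<bar>R\<bar> / (1 - q)" and "k = Im w / (Im z * r)"
  have c: "c \<ge> 0"
    using q by (simp add: c_def)
  have k: "k > 0"
    using w z r by (simp add: k_def)
  show thesis
  proof (rule that)
    fix z' w' assume z': "r \<le> Im z'" and R: "cmod (z' - z) \<le> R" and w': "Im w' > 0" and fixed': "step z' w' = w'"
    define A where "A = cmod (w' - w)"
    have "Im z' > 0"
      using r z' by simp
    have "Im w' \<le> Im w + A"
      using abs_Im_le_cmod[of "w' - w"] by (simp add: A_def)
    have "Im w * Im w' / (Im z * Im z') \<le> k * Im w'"
      using z z' r w w' unfolding k_def by (simp add: field_simps)
    also have "\<dots> \<le> k * (Im w + A)"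
      using \<open>Im w' \<le> _\<close> k by simp
    finally have "sqrt (Im w * Im w' / (Im z * Im z')) \<le> sqrt (k * (Im w + A))"
      by simp
    moreover have "A * (1 - q) \<le> cmod (z' - z) * (1 + sqrt (Im w * Im w' / (Im z * Im z')))"
      using fixed_point_stability(2)[OF z \<open>Im z' > 0\<close> w w' fixed fixed'] by (simp add: q_def A_def)
    ultimately have "A * (1 - q) \<le> cmod (z' - z) * (1 + sqrt (k * (Im w + A)))"
      by (smt (verit) mult_left_mono norm_ge_zero)
    also have "\<dots> \<le> \<bar>R\<bar> * (1 + sqrt (k * (Im w + A)))"
      using R k w by (intro mult_right_mono) (auto simp: A_def)
    finally have "A * (1 - q) \<le> \<bar>R\<bar> * (1 + sqrt (k * (Im w + A)))" .
    then have "A \<le> c * (1 + sqrt (k * (Im w + A)))"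
      using q by (simp add: c_def field_simps)
    also have "\<dots> = c + sqrt ((c^2 * k) * (Im w + A))"
      unfolding real_sqrt_mult real_sqrt_abs using c by (simp add: algebra_simps)
    \<comment> \<open>The arithmetic-geometric mean inequality leaves only \<open>A / 2\<close> on
      the right, to be absorbed on the left.\<close>
    also have "sqrt ((c^2 * k) * (Im w + A)) \<le> (c^2 * k + (Im w + A)) / 2"
      using k w by (intro arith_geo_mean_sqrt) (auto simp: A_def)
    finally have "A \<le> c + (c^2 * k + (Im w + A)) / 2"
      by simp
    then show "cmod (w' - w) \<le> 2 * c + c^2 * k + Im w"
      by (simp add: field_simps flip: A_def)
  qed
qed

section \<open>Continuation of solutions in the parameter\<close>

text \<open>Infinitesimal form of the bound on divided differences: after exchanging denominators
  both ratios are below 1 at a solution. It provides the contraction for nearby parameters and the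
  nonvanishing of \<open>1 - d2 * d1\<close>.\<close>

lemma deriv_product_less_1:
  assumes z: "Im z > 0" and w: "Im w > 0" and fixed: "step z w = w"
    and d1: "(H1 has_field_derivative d1) (at w)"
    and d2: "(H2 has_field_derivative d2) (at (z + H1 w))"
  shows "cmod d2 * cmod d1 < 1"
proof -
  define u where "u = z + H1 w"
  have u: "Im u > 0" "Im (H1 w) < Im u"
    using z pos1[OF w] by (auto simp: u_def)
  have v: "Im (H2 u) = Im w - Im z"
    using arg_cong[OF fixed, of Im] by (simp add: step_def u_def)
  have "cmod d2 * cmod d1 \<le> (Im (H2 u) / Im u) * (Im (H1 w) / Im w)"
    using Schwarz_Pick_deriv[OF hol1 pos1 w d1] Schwarz_Pick_deriv[OF hol2 pos2 u(1)] d2 pos2[OF u(1)] u(1)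
    by (intro mult_mono) (auto simp: u_def)
  also have "\<dots> = (Im (H2 u) / Im w) * (Im (H1 w) / Im u)"
    by simp
  also have "\<dots> < 1 * 1"
    using u v pos2[OF u(1)] w z pos1[OF w] by (intro mult_strict_mono) auto
  finally show ?thesis by simp
qed

lemma has_derivative_H:
  assumes "Im w > 0"
  shows "(H1 has_field_derivative deriv H1 w) (at w)" "(H2 has_field_derivative deriv H2 w) (at w)"
  using assms hol1 hol2 by (auto intro!: holomorphic_derivI open_halfspace_Im_gt)

text \<open>The local Lipschitz constants of \<open>H1\<close> at \<open>w\<close> and
  \<open>H2\<close> at \<open>u\<close> have product below 1, so \<open>step z'\<close> maps a small
  closed disc about \<open>w\<close> into itself, and Brouwer applies. The control by
  \<open>\<epsilon>\<close> later yields continuity of the solution.\<close>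

lemma fixed_point_nearby:
  assumes z: "Im z > 0" and w: "Im w > 0" and fixed: "step z w = w" and \<epsilon>: "\<epsilon> > 0"
  obtains \<delta> where "\<delta> > 0"
    "\<And>z'. cmod (z' - z) < \<delta> \<Longrightarrow> \<exists>w'. Im w' > 0 \<and> cmod (w' - w) \<le> \<epsilon> \<and> step z' w' = w'"
proof -
  define u where "u = z + H1 w"
  have u: "Im u > 0"
    using z pos1[OF w] by (simp add: u_def)
  have wu: "w = z + H2 u"
    using fixed by (simp add: u_def step_def)
  define d1 d2 where "d1 = deriv H1 w" and "d2 = deriv H2 u"
  have d1: "(H1 has_field_derivative d1) (at w)" and d2: "(H2 has_field_derivative d2) (at u)"
    using has_derivative_H w u by (auto simp: d1_def d2_def)
  have lt: "cmod d2 * cmod d1 < 1"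
    using deriv_product_less_1[OF z w fixed d1] d2 by (simp add: u_def)
  obtain e where e: "e > 0" "(cmod d2 + e) * (cmod d1 + e) < 1"
  proof -
    have "((\<lambda>e. (cmod d2 + e) * (cmod d1 + e)) \<longlongrightarrow> (cmod d2 + 0) * (cmod d1 + 0)) (at_right 0)"
      by (intro tendsto_intros)
    then have "eventually (\<lambda>e. (cmod d2 + e) * (cmod d1 + e) < 1) (at_right 0)"
      using lt by (intro order_tendstoD(2)) auto
    then have "eventually (\<lambda>e. (cmod d2 + e) * (cmod d1 + e) < 1 \<and> e > 0) (at_right (0::real))"
      using eventually_at_right_less[of "0::real"] by eventually_elim auto
    then show ?thesis
      using that eventually_happens'[OF trivial_limit_at_right_real] by blast
  qed
  define l1 l2 where "l1 = cmod d1 + e" and "l2 = cmod d2 + e"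
  have l: "l1 > 0" "l2 > 0" "l2 * l1 < 1"
    using e by (auto simp: l1_def l2_def add_nonneg_pos)
  obtain r1 where r1: "r1 > 0" "\<And>x. cmod (x - w) \<le> r1 \<Longrightarrow> cmod (H1 x - H1 w) \<le> l1 * cmod (x - w)"
    using lipschitz_near[OF d1 e(1)] unfolding l1_def by blast
  obtain r2 where r2: "r2 > 0" "\<And>x. cmod (x - u) \<le> r2 \<Longrightarrow> cmod (H2 x - H2 u) \<le> l2 * cmod (x - u)"
    using lipschitz_near[OF d2 e(1)] unfolding l2_def by blast
  \<comment> \<open>The third entry reserves half of \<open>r2\<close> for the variation of
    \<open>H1\<close>, the other half going to \<open>z' - z\<close>; the last keeps the disc in the
    half-plane.\<close>
  define r where "r = Min {\<epsilon>, r1, r2 / (2 * l1), Im w / 2}"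
  have r: "r > 0" "r \<le> \<epsilon>" "r \<le> r1" "l1 * r \<le> r2 / 2" "r < Im w"
  proof -
    show "r > 0"
      using \<epsilon> r1(1) r2(1) l w by (simp add: r_def)
    have "r \<le> r2 / (2 * l1)"
      unfolding r_def by (intro Min_le) auto
    then show "l1 * r \<le> r2 / 2"
      using l by (simp add: field_simps)
    have "r \<le> Im w / 2"
      unfolding r_def by (intro Min_le) auto
    then show "r < Im w"
      using w by simp
  qed (auto simp: r_def)
  \<comment> \<open>The last entry is \<open>\<delta> + l2 * (\<delta> + l1 * r) \<le> r\<close>
    solved for \<open>\<delta>\<close>: the image of the disc stays in the disc.\<close>
  define \<delta> where "\<delta> = Min {Im z, r2 / 2, (1 - l2 * l1) * r / (1 + l2)}"
  have \<delta>: "\<delta> > 0" "\<delta> \<le> Im z" "\<delta> \<le> r2 / 2" "\<delta> * (1 + l2) \<le> (1 - l2 * l1) * r"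
  proof -
    show "\<delta> > 0"
      using z r2(1) l r by (simp add: \<delta>_def)
    show "\<delta> \<le> Im z" "\<delta> \<le> r2 / 2"
      unfolding \<delta>_def by (intro Min_le; simp)+
    have "\<delta> \<le> (1 - l2 * l1) * r / (1 + l2)"
      unfolding \<delta>_def by (intro Min_le) auto
    then show "\<delta> * (1 + l2) \<le> (1 - l2 * l1) * r"
      using l by (simp add: field_simps)
  qed
  have sub: "cball w r \<subseteq> {z. Im z > 0}"
  proof
    fix x assume "x \<in> cball w r"
    then have "\<bar>Im (w - x)\<bar> \<le> r"
      using abs_Im_le_cmod[of "w - x"] by (simp add: dist_norm)
    then show "x \<in> {z. Im z > 0}"
      using r by simp
  qed
  show thesis
  proof (rule that[OF \<delta>(1)])
    fix z' assume z': "cmod (z' - z) < \<delta>"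
    have Imz': "Im z' > 0"
      using abs_Im_le_cmod[of "z' - z"] z' \<delta> by simp
    have "step z' x \<in> cball w r" if "x \<in> cball w r" for x
    proof -
      have x: "cmod (x - w) \<le> r"
        using that by (simp add: dist_norm norm_minus_commute)
      define y where "y = z' + H1 x"
      have "cmod (y - u) \<le> cmod (z' - z) + cmod (H1 x - H1 w)"
        using norm_triangle_ineq[of "z' - z" "H1 x - H1 w"] by (simp add: y_def u_def algebra_simps)
      also have "\<dots> \<le> cmod (z' - z) + l1 * cmod (x - w)"
        using r1(2)[of x] x r by auto
      also have "\<dots> \<le> \<delta> + l1 * r"
        using z' x l by (intro add_mono mult_left_mono) auto
      finally have y: "cmod (y - u) \<le> \<delta> + l1 * r" .
      have "cmod (step z' x - w) \<le> cmod (z' - z) + cmod (H2 y - H2 u)"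
        using norm_triangle_ineq[of "z' - z" "H2 y - H2 u"] wu
        by (simp add: step_def flip: y_def) (simp add: algebra_simps)
      also have "\<dots> \<le> cmod (z' - z) + l2 * cmod (y - u)"
        using r2(2)[of y] y r \<delta> by auto
      also have "\<dots> \<le> \<delta> + l2 * (\<delta> + l1 * r)"
        using z' y l by (intro add_mono mult_left_mono) auto
      also have "\<dots> \<le> r"
        using \<delta>(4) by (simp add: algebra_simps)
      finally show ?thesis
        by (simp add: dist_norm norm_minus_commute)
    qed
    then obtain w' where "w' \<in> cball w r" "step z' w' = w'"
      using brouwer_step[OF Imz' sub] r by auto
    then show "\<exists>w'. Im w' > 0 \<and> cmod (w' - w) \<le> \<epsilon> \<and> step z' w' = w'"
      using sub r by (intro exI[of _ w']) (auto simp: dist_norm norm_minus_commute)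
  qed
qed

text \<open>Connectedness of the half-plane: the set of solvable parameters is open by
  \<open>fixed_point_nearby\<close>, and closed because solutions along a convergent parameter
  sequence are bounded and subconverge to a solution.\<close>

lemma fixed_point_everywhere:
  assumes base: "Im z0 > 0" "Im w0 > 0" "step z0 w0 = w0" and z: "Im z > 0"
  shows "\<exists>w. Im w > 0 \<and> step z w = w"
proof -
  define U where "U = {z. Im z > 0}"
  define S where "S = {z\<in>U. \<exists>w. Im w > 0 \<and> step z w = w}"
  have op: "open U" and con: "connected U"
    by (auto simp: U_def open_halfspace_Im_gt intro: convex_connected convex_halfspace_Im_gt)
  have "open S"
    unfolding open_dist
  proof
    fix z assume "z \<in> S"
    then obtain w where w: "Im z > 0" "Im w > 0" "step z w = w"
      by (auto simp: S_def U_def)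
    obtain \<delta> where \<delta>: "\<delta> > 0" "\<And>z'. cmod (z' - z) < \<delta> \<Longrightarrow> \<exists>w'. Im w' > 0 \<and> cmod (w' - w) \<le> 1 \<and> step z' w' = w'"
      using fixed_point_nearby[OF w, of 1] by auto
    obtain \<delta>' where "\<delta>' > 0" "\<forall>z'. dist z' z < \<delta>' \<longrightarrow> z' \<in> U"
      using op w unfolding open_dist U_def by blast
    then show "\<exists>e>0. \<forall>y. dist y z < e \<longrightarrow> y \<in> S"
      using \<delta> unfolding S_def dist_norm by (intro exI[of _ "min \<delta> \<delta>'"]) (simp, blast)
  qed
  then have "openin (top_of_set U) S"
    by (auto simp: S_def intro: open_subset)
  moreover have "closedin (top_of_set U) S"
    unfolding closedin_limpt
  proof (intro conjI allI impI)
    show "S \<subseteq> U"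
      by (auto simp: S_def)
    fix z assume z: "z islimpt S \<and> z \<in> U"
    then have Imz: "Im z > 0"
      by (simp add: U_def)
    obtain \<zeta> where \<zeta>: "\<And>n. \<zeta> n \<in> S" "\<zeta> \<longlonglongrightarrow> z"
      using z unfolding islimpt_sequential by auto
    then obtain \<omega> where \<omega>: "\<And>n. Im (\<omega> n) > 0" "\<And>n. step (\<zeta> n) (\<omega> n) = \<omega> n"
      unfolding S_def by (simp, metis)
    \<comment> \<open>This keeps the parameters at height at least \<open>Im z / 2\<close>, the
      lower bound demanded by \<open>fixed_points_bounded\<close>.\<close>
    have "eventually (\<lambda>n. dist (\<zeta> n) z < Im z / 2) sequentially"
      using \<zeta>(2) Imz by (intro tendstoD) auto
    then obtain N where N: "\<And>n. n \<ge> N \<Longrightarrow> cmod (\<zeta> n - z) < Im z / 2"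
      by (auto simp: eventually_sequentially dist_norm)
    have *: "Im (\<zeta> n) \<ge> Im z / 2" "cmod (\<zeta> n - z0) \<le> Im z / 2 + cmod (z - z0)" if "n \<ge> N" for n
      using abs_Im_le_cmod[of "\<zeta> n - z"] N[OF that] norm_triangle_ineq[of "\<zeta> n - z" "z - z0"] by auto
    obtain B where B: "\<And>z' w'. Im z / 2 \<le> Im z' \<Longrightarrow> cmod (z' - z0) \<le> Im z / 2 + cmod (z - z0)
         \<Longrightarrow> Im w' > 0 \<Longrightarrow> step z' w' = w' \<Longrightarrow> cmod (w' - w0) \<le> B"
      using fixed_points_bounded[OF base, of "Im z / 2" "Im z / 2 + cmod (z - z0)"] Imz by auto
    have "\<omega> (n + N) \<in> cball w0 B" for n
      using B[of "\<zeta> (n + N)" "\<omega> (n + N)"] *[of "n + N"] \<omega> by (simp add: dist_norm norm_minus_commute)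
    then obtain w r where r: "strict_mono r" "((\<lambda>n. \<omega> (n + N)) \<circ> r) \<longlonglongrightarrow> w"
      using compact_imp_seq_compact[OF compact_cball, of w0 B] unfolding seq_compact_def by metis
    define k where "k = (\<lambda>n. r n + N)"
    have k: "(\<lambda>n. \<omega> (k n)) \<longlonglongrightarrow> w"
      using r by (simp add: k_def o_def)
    have "(\<lambda>n. \<zeta> (n + N)) \<longlonglongrightarrow> z"
      using \<zeta>(2) by (rule LIMSEQ_ignore_initial_segment)
    then have \<zeta>k: "(\<lambda>n. \<zeta> (k n)) \<longlonglongrightarrow> z"
      using LIMSEQ_subseq_LIMSEQ[OF _ r(1)] by (force simp: k_def o_def)
    have "Im (\<zeta> (k n)) \<le> Im (\<omega> (k n))" for n
      using Im_step[of "\<zeta> (k n)" "\<omega> (k n)"] \<omega> \<zeta>(1)[of "k n"] by (auto simp: S_def U_def)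
    then have "Im z \<le> Im w"
      using LIMSEQ_le[OF tendsto_Im[OF \<zeta>k] tendsto_Im[OF k]] by blast
    then have Imw: "Im w > 0"
      using Imz by simp
    then have "Im (z + H1 w) > 0"
      using Imz pos1[of w] by simp
    then have "(\<lambda>n. step (\<zeta> (k n)) (\<omega> (k n))) \<longlonglongrightarrow> step z w"
      unfolding step_def
      by (intro tendsto_intros \<zeta>k isCont_tendsto_compose[OF isCont_H(2)] isCont_tendsto_compose[OF isCont_H(1)] k Imw)
    then have "step z w = w"
      using k \<omega>(2) LIMSEQ_unique by auto
    then show "z \<in> S"
      using Imw z by (auto simp: S_def)
  qed
  moreover have "S \<noteq> {}"
    using base by (auto simp: S_def U_def)
  ultimately have "S = U"
    using con unfolding connected_clopen by blast
  then show ?thesis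
    using z by (auto simp: S_def U_def)
qed

section \<open>Holomorphic dependence on the parameter\<close>

text \<open>Continuity comes from \<open>fixed_point_nearby\<close> and uniqueness. The system then
  expresses the difference quotient of \<open>\<omega>\<close> through the slopes of
  \<open>H1\<close> and \<open>H2\<close>, and \<open>1 - d2 * d1 \<noteq> 0\<close> lets it
  converge.\<close>

lemma fixed_point_holomorphic:
  assumes \<omega>: "\<And>z. Im z > 0 \<Longrightarrow> Im (\<omega> z) > 0 \<and> step z (\<omega> z) = \<omega> z"
  shows "\<omega> holomorphic_on {z. Im z > 0}"
proof -
  have "\<omega> field_differentiable at z" if z: "Im z > 0" for z
  proof -
    define w u where "w = \<omega> z" and "u = z + H1 w"
    have w: "Im w > 0" and fixed: "step z w = w"
      using \<omega>[OF z] by (auto simp: w_def)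
    have u: "Im u > 0"
      using z pos1[OF w] by (simp add: u_def)
    define \<upsilon> where "\<upsilon> = (\<lambda>x. x + H1 (\<omega> x))"
    have near: "eventually (\<lambda>x. Im x > 0) (at z)"
      using eventually_at_in_open'[OF open_halfspace_Im_gt[of 0], of z] z by simp
    have lim\<omega>: "(\<omega> \<longlongrightarrow> w) (at z)"
    proof (rule tendstoI)
      fix \<epsilon> :: real assume "\<epsilon> > 0"
      then obtain \<delta> where \<delta>: "\<delta> > 0" "\<And>z'. cmod (z' - z) < \<delta> \<Longrightarrow> \<exists>w'. Im w' > 0 \<and> cmod (w' - w) \<le> \<epsilon> / 2 \<and> step z' w' = w'"
        using fixed_point_nearby[OF z w fixed, of "\<epsilon> / 2"] by auto
      have "eventually (\<lambda>x. dist x z < \<delta>) (at z)"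
        using \<delta>(1) by (auto simp: eventually_at)
      with near show "eventually (\<lambda>x. dist (\<omega> x) w < \<epsilon>) (at z)"
      proof eventually_elim
        case (elim x)
        then obtain w' where w': "Im w' > 0" "cmod (w' - w) \<le> \<epsilon> / 2" "step x w' = w'"
          using \<delta>(2)[of x] by (auto simp: dist_norm)
        then have "\<omega> x = w'"
          using fixed_point_unique[of x w' "\<omega> x"] \<omega>[of x] elim by auto
        then show ?case
          using w' \<open>\<epsilon> > 0\<close> by (simp add: dist_norm)
      qed
    qed
    then have lim\<upsilon>: "(\<upsilon> \<longlongrightarrow> u) (at z)"
      unfolding \<upsilon>_def u_def by (intro tendsto_intros isCont_tendsto_compose[OF isCont_H(1)] w)
    define d1 d2 where "d1 = deriv H1 w" and "d2 = deriv H2 u"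
    have d1: "(H1 has_field_derivative d1) (at w)" and d2: "(H2 has_field_derivative d2) (at u)"
      using has_derivative_H w u by (auto simp: d1_def d2_def)
    \<comment> \<open>Caratheodory slopes also make sense where \<open>\<omega> x = w\<close>, so no
      division by \<open>\<omega> x - w\<close> occurs.\<close>
    obtain g1 where g1: "\<And>x. H1 x - H1 w = g1 x * (x - w)" "isCont g1 w" "g1 w = d1"
      using d1 unfolding DERIV_caratheodory_within by blast
    obtain g2 where g2: "\<And>x. H2 x - H2 u = g2 x * (x - u)" "isCont g2 u" "g2 u = d2"
      using d2 unfolding DERIV_caratheodory_within by blast
    have limg1: "((\<lambda>x. g1 (\<omega> x)) \<longlongrightarrow> d1) (at z)"
      using isCont_tendsto_compose[OF g1(2) lim\<omega>] g1(3) by simp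
    have limg2: "((\<lambda>x. g2 (\<upsilon> x)) \<longlongrightarrow> d2) (at z)"
      using isCont_tendsto_compose[OF g2(2) lim\<upsilon>] g2(3) by simp
    have "cmod (d2 * d1) < 1"
      using deriv_product_less_1[OF z w fixed d1] d2 by (simp add: u_def norm_mult)
    then have ne: "1 - d2 * d1 \<noteq> 0"
      by auto
    have lim: "((\<lambda>x. (1 + g2 (\<upsilon> x)) / (1 - g2 (\<upsilon> x) * g1 (\<omega> x))) \<longlongrightarrow> (1 + d2) / (1 - d2 * d1)) (at z)"
      by (intro tendsto_intros limg1 limg2 ne)
    have "((\<lambda>x. 1 - g2 (\<upsilon> x) * g1 (\<omega> x)) \<longlongrightarrow> 1 - d2 * d1) (at z)"
      by (intro tendsto_intros limg1 limg2)
    then have "eventually (\<lambda>x. 1 - g2 (\<upsilon> x) * g1 (\<omega> x) \<noteq> 0) (at z)"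
      by (rule tendsto_imp_eventually_ne[OF _ ne])
    moreover have "eventually (\<lambda>x. x \<noteq> z) (at z)"
      by (simp add: eventually_at_filter)
    ultimately have "eventually (\<lambda>x. (1 + g2 (\<upsilon> x)) / (1 - g2 (\<upsilon> x) * g1 (\<omega> x)) = (\<omega> x - \<omega> z) / (x - z)) (at z)"
      using near
    proof eventually_elim
      case (elim x)
      have "\<omega> x = x + H2 (\<upsilon> x)" "w = z + H2 u"
        using \<omega>[of x] elim fixed by (auto simp: step_def \<upsilon>_def u_def)
      then have "\<omega> x - w = (x - z) + g2 (\<upsilon> x) * (\<upsilon> x - u)"
        using g2(1)[of "\<upsilon> x"] by (simp add: algebra_simps)
      moreover have "\<upsilon> x - u = (x - z) + g1 (\<omega> x) * (\<omega> x - w)"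
        using g1(1)[of "\<omega> x"] by (simp add: \<upsilon>_def u_def algebra_simps)
      \<comment> \<open>Elimination of \<open>\<upsilon> x - u\<close> from the two linear
        relations.\<close>
      ultimately have "(\<omega> x - w) * (1 - g2 (\<upsilon> x) * g1 (\<omega> x)) = (1 + g2 (\<upsilon> x)) * (x - z)"
        by algebra
      then show ?case
        using elim unfolding w_def[symmetric] by (simp add: frac_eq_eq)
    qed
    then have "(\<omega> has_field_derivative (1 + d2) / (1 - d2 * d1)) (at z)"
      unfolding has_field_derivative_iff using lim by (rule Lim_transform_eventually[rotated])
    then show ?thesis
      unfolding field_differentiable_def by blast
  qed
  then show ?thesis
    by (auto simp: holomorphic_on_def intro: field_differentiable_at_within)
qed

section \<open>Solutions for parameters high on the imaginary axis\<close>

text \<open>\<open>half_plane_growth\<close> carries the smallness of \<open>H1\<close> and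
  \<open>H2\<close> at \<open>p = \<i> * y\<close> to the disc of radius \<open>\<delta> * y\<close>
  about \<open>p\<close>. Then \<open>p + H1 w\<close> and \<open>step p w\<close> both stay in that
  disc.\<close>

lemma fixed_point_near_i:
  assumes lim1: "((\<lambda>y::real. H1 (\<i> * of_real y) / of_real y) \<longlongrightarrow> 0) at_top"
    and lim2: "((\<lambda>y::real. H2 (\<i> * of_real y) / of_real y) \<longlongrightarrow> 0) at_top"
    and \<delta>: "0 < \<delta>" "\<delta> \<le> 1 / 2"
  shows "eventually (\<lambda>y::real. \<exists>w. Im w > 0 \<and> cmod (w - \<i> * of_real y) \<le> \<delta> * y \<and> step (\<i> * of_real y) w = w) at_top"
proof -
  \<comment> \<open>The growth factor on the disc is at most 15: there
    \<open>cmod (w - cnj p) \<le> 5 / 2 * y\<close> and \<open>Im w * Im p \<ge> y^2 / 2\<close>,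
    giving \<open>2 + 25 / 2\<close>.\<close>
  have "eventually (\<lambda>y. dist (H1 (\<i> * of_real y) / of_real y) 0 < \<delta> / 15) at_top"
    "eventually (\<lambda>y. dist (H2 (\<i> * of_real y) / of_real y) 0 < \<delta> / 15) at_top"
    using \<delta> tendstoD[OF lim1, of "\<delta> / 15"] tendstoD[OF lim2, of "\<delta> / 15"] by simp_all
  then show ?thesis
    using eventually_gt_at_top[of 0]
  proof eventually_elim
    case (elim y)
    define p where "p = \<i> * complex_of_real y"
    have p: "Im p > 0"
      using elim by (simp add: p_def)
    have sub: "Im w \<ge> y / 2" if "cmod (w - p) \<le> \<delta> * y" for w
    proof -
      have "\<bar>Im w - y\<bar> \<le> \<delta> * y"
        using that abs_Im_le_cmod[of "w - p"] by (simp add: p_def)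
      moreover have "\<delta> * y \<le> (1 / 2) * y"
        using \<delta> elim by (intro mult_right_mono) auto
      ultimately show ?thesis by linarith
    qed
    have main: "cmod (H w) \<le> \<delta> * y" if hol: "H holomorphic_on {z. Im z > 0}"
      and pos: "\<And>z. Im z > 0 \<Longrightarrow> Im (H z) > 0" and small: "cmod (H p) \<le> \<delta> / 15 * y"
      and w: "cmod (w - p) \<le> \<delta> * y" for H w
    proof -
      have Imw: "Im w \<ge> y / 2" "Im w > 0"
        using sub[OF w] elim by auto
      have "cmod (w - cnj p) \<le> cmod (w - p) + cmod (p - cnj p)"
        using norm_triangle_ineq[of "w - p" "p - cnj p"] by simp
      also have "cmod (p - cnj p) = 2 * y"
        using elim by (simp add: p_def norm_mult)
      also have "cmod (w - p) \<le> (1 / 2) * y"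
        using w \<delta> elim mult_right_mono[of \<delta> "1/2" y] by linarith
      finally have "cmod (w - cnj p) \<le> 5 / 2 * y"
        by simp
      then have "cmod (w - cnj p)^2 \<le> (5 / 2 * y)^2"
        by (intro power_mono) auto
      moreover have "y / 2 * y \<le> Im w * Im p"
        using Imw elim by (simp add: p_def)
      ultimately have "cmod (w - cnj p)^2 / (Im w * Im p) \<le> (5 / 2 * y)^2 / (y / 2 * y)"
        using elim by (intro frac_le) auto
      also have "\<dots> \<le> 13"
        using elim by (simp add: field_simps power2_eq_square)
      finally have "2 + cmod (w - cnj p)^2 / (Im w * Im p) \<le> 15"
        by simp
      then have "cmod (H p) * (2 + cmod (w - cnj p)^2 / (Im w * Im p)) \<le> cmod (H p) * 15"
        by (intro mult_left_mono) auto
      then show ?thesis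
        using half_plane_growth[OF hol pos Imw(2) p] small by linarith
    qed
    have small: "cmod (H1 p) \<le> \<delta> / 15 * y" "cmod (H2 p) \<le> \<delta> / 15 * y"
      using elim by (auto simp: p_def norm_divide field_simps)
    have "step p w \<in> cball p (\<delta> * y)" if "w \<in> cball p (\<delta> * y)" for w
    proof -
      have "cmod (w - p) \<le> \<delta> * y"
        using that by (simp add: dist_norm norm_minus_commute)
      then have "cmod (H1 w) \<le> \<delta> * y"
        by (intro main[OF hol1 pos1 small(1)])
      then have "cmod (H2 (p + H1 w)) \<le> \<delta> * y"
        by (intro main[OF hol2 pos2 small(2)]) auto
      then show ?thesis
        by (simp add: step_def dist_norm)
    qed
    moreover have "cball p (\<delta> * y) \<subseteq> {z. Im z > 0}"
      using sub elim by (fastforce simp: dist_norm norm_minus_commute)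
    ultimately obtain w where w: "w \<in> cball p (\<delta> * y)" "step p w = w" "Im w > 0"
      using brouwer_step[OF p, of p "\<delta> * y"] \<delta> elim by (auto simp: subset_eq)
    then show ?case
      by (intro exI[of _ w]) (auto simp: p_def dist_norm norm_minus_commute)
  qed
qed

end

section \<open>Return from the coupled system to \<open>F1\<close>, \<open>F2\<close> and
  \<open>f\<close>\<close>

theorem theorem1p16:
  fixes F1 F2 :: "complex \<Rightarrow> complex" and f :: "complex \<Rightarrow> complex \<Rightarrow> complex"
  assumes "F1 analytic_on upper_half_plane" and "F1 \<in> upper_half_plane \<rightarrow> upper_half_plane"
    and "F2 analytic_on upper_half_plane" and "F2 \<in> upper_half_plane \<rightarrow> upper_half_plane"
    and "\<not> conformal_automorphism upper_half_plane F1"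
    and "\<not> conformal_automorphism upper_half_plane F2"
    and "((\<lambda>y::real. F1 (\<i> * of_real y) / (\<i> * of_real y)) \<longlongrightarrow> 1) at_top"
    and "((\<lambda>y::real. F2 (\<i> * of_real y) / (\<i> * of_real y)) \<longlongrightarrow> 1) at_top"
    and f: "\<And>z w. z \<in> upper_half_plane \<union> \<real> \<Longrightarrow> w \<in> upper_half_plane \<Longrightarrow>
              f z w = F2 (F1 w - w + z) - (F1 w - w)"
  shows "(\<forall>z \<in> upper_half_plane \<union> \<real>. \<forall>w \<in> upper_half_plane.
            F1 w - w + z \<in> upper_half_plane \<and> f z w \<in> upper_half_plane) \<and>
         (\<exists>\<omega>. (\<omega> analytic_on upper_half_plane \<and> \<omega> \<in> upper_half_plane \<rightarrow> upper_half_plane \<and>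
                (\<forall>z \<in> upper_half_plane. f z (\<omega> z) = \<omega> z)) \<and>
              (\<forall>\<omega>'. \<omega>' analytic_on upper_half_plane \<and> \<omega>' \<in> upper_half_plane \<rightarrow> upper_half_plane \<and>
                (\<forall>z \<in> upper_half_plane. f z (\<omega>' z) = \<omega>' z) \<longrightarrow>
                (\<forall>z \<in> upper_half_plane. \<omega>' z = \<omega> z)) \<and>
              ((\<lambda>y::real. \<omega> (\<i> * of_real y) / (\<i> * of_real y)) \<longlongrightarrow> 1) at_top)"
proof -
  define H1 H2 where "H1 = (\<lambda>w. F1 w - w)" and "H2 = (\<lambda>w. F2 w - w)"
  have pos1: "Im (H1 w) > 0" and pos2: "Im (H2 w) > 0" if "Im w > 0" for w
    using non_automorphism_Im_less[OF assms(1,2,5,7) that] non_automorphism_Im_less[OF assms(3,4,6,8) that]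
    by (simp_all add: H1_def H2_def)
  interpret half_plane_pair H1 H2
  proof
    show "H1 holomorphic_on {z. Im z > 0}" "H2 holomorphic_on {z. Im z > 0}"
      using assms(1,3) unfolding H1_def H2_def upper_half_plane_def
      by (auto intro!: analytic_intros analytic_imp_holomorphic)
  qed (fact pos1 pos2)+
  have f_step: "f z w = step z w" if "z \<in> upper_half_plane \<union> \<real>" "Im w > 0" for z w
  proof -
    have "step z w = z + H2 (z + H1 w)"
      by (rule step_def)
    also have "\<dots> = F2 (F1 w - w + z) - (F1 w - w)"
      by (simp add: H1_def H2_def algebra_simps)
    finally show ?thesis
      using f[OF that(1), of w] that(2) by (simp add: upper_half_plane_def)
  qed
  have lim: "((\<lambda>y::real. (F (\<i> * of_real y) - \<i> * of_real y) / of_real y) \<longlongrightarrow> 0) at_top"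
    if "((\<lambda>y::real. F (\<i> * of_real y) / (\<i> * of_real y)) \<longlongrightarrow> 1) at_top" for F :: "complex \<Rightarrow> complex"
  proof -
    have "((\<lambda>y::real. \<i> * (F (\<i> * of_real y) / (\<i> * of_real y)) - \<i>) \<longlongrightarrow> \<i> * 1 - \<i>) at_top"
      by (intro tendsto_intros that)
    moreover have "eventually (\<lambda>y::real. \<i> * (F (\<i> * of_real y) / (\<i> * of_real y)) - \<i>
        = (F (\<i> * of_real y) - \<i> * of_real y) / of_real y) at_top"
      using eventually_gt_at_top[of 0] by eventually_elim (simp add: diff_divide_distrib)
    ultimately show ?thesis
      using Lim_transform_eventually by fastforce
  qed
  have lim1: "((\<lambda>y::real. H1 (\<i> * of_real y) / of_real y) \<longlongrightarrow> 0) at_top"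
    and lim2: "((\<lambda>y::real. H2 (\<i> * of_real y) / of_real y) \<longlongrightarrow> 0) at_top"
    using lim[OF assms(7)] lim[OF assms(8)] by (simp_all add: H1_def H2_def)
  have near: "eventually (\<lambda>y::real. (\<exists>w. Im w > 0 \<and> cmod (w - \<i> * of_real y) \<le> \<delta> * y
      \<and> step (\<i> * of_real y) w = w) \<and> y > 0) at_top" if "0 < \<delta>" "\<delta> \<le> 1 / 2" for \<delta>
    using fixed_point_near_i[OF lim1 lim2 that] eventually_gt_at_top[of 0] by eventually_elim simp
  obtain y0 w0 where base: "y0 > 0" "Im w0 > 0" "step (\<i> * of_real y0) w0 = w0"
    using eventually_happens'[OF _ near[of "1 / 2"]] by auto
  have "\<exists>w. Im w > 0 \<and> step z w = w" if "Im z > 0" for z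
    using fixed_point_everywhere[OF _ base(2,3) that] base(1) by simp
  \<comment> \<open>A pointwise choice of solutions; its analyticity follows from
    \<open>fixed_point_holomorphic\<close>.\<close>
  then obtain \<omega> where \<omega>: "\<And>z. Im z > 0 \<Longrightarrow> Im (\<omega> z) > 0 \<and> step z (\<omega> z) = \<omega> z"
    by metis
  have "((\<lambda>y::real. \<omega> (\<i> * of_real y) / (\<i> * of_real y)) \<longlongrightarrow> 1) at_top"
  proof (rule tendstoI)
    fix e :: real assume "e > 0"
    \<comment> \<open>The bound \<open>1 / 2\<close> is what \<open>near\<close> requires, and
      \<open>e / 2\<close> makes the final estimate strict.\<close>
    define \<delta> where "\<delta> = min (e / 2) (1 / 2)"
    have \<delta>: "0 < \<delta>" "\<delta> \<le> 1 / 2" "\<delta> < e"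
      using \<open>e > 0\<close> by (auto simp: \<delta>_def)
    show "eventually (\<lambda>y::real. dist (\<omega> (\<i> * of_real y) / (\<i> * of_real y)) 1 < e) at_top"
      using near[OF \<delta>(1,2)]
    proof eventually_elim
      case (elim y)
      define p where "p = \<i> * complex_of_real y"
      have p: "Im p > 0" "p \<noteq> 0" "cmod p = y"
        using elim by (auto simp: p_def norm_mult)
      obtain w where w: "Im w > 0" "cmod (w - p) \<le> \<delta> * y" "step p w = w"
        using elim by (auto simp: p_def)
      \<comment> \<open>Uniqueness identifies the chosen solution with the one that Brouwer's
        theorem places near \<open>p\<close>.\<close>
      have "\<omega> p = w"
        using fixed_point_unique[OF p(1) w(1) _ w(3)] \<omega>[OF p(1)] by simp
      have "dist (\<omega> p / p) 1 = cmod ((w - p) / p)"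
        using p by (simp add: dist_norm \<open>\<omega> p = w\<close> diff_divide_distrib)
      also have "\<dots> \<le> \<delta>"
        using w(2) p elim by (simp add: norm_divide field_simps)
      finally show ?case
        using \<delta>(3) by (simp add: p_def)
    qed
  qed
  moreover have "\<omega> analytic_on upper_half_plane"
    using fixed_point_holomorphic[OF \<omega>] by (simp add: upper_half_plane_def analytic_on_open open_halfspace_Im_gt)
  moreover have "\<forall>z \<in> upper_half_plane. f z (\<omega> z) = \<omega> z" "\<omega> \<in> upper_half_plane \<rightarrow> upper_half_plane"
    using \<omega> f_step by (auto simp: upper_half_plane_def)
  moreover have "\<omega>' z = \<omega> z"
    if "\<omega>' \<in> upper_half_plane \<rightarrow> upper_half_plane" "\<forall>z \<in> upper_half_plane. f z (\<omega>' z) = \<omega>' z"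
      "z \<in> upper_half_plane" for \<omega>' z
  proof -
    have pos: "Im (\<omega>' z) > 0"
      using that(1,3) by (auto simp: upper_half_plane_def)
    then have "step z (\<omega>' z) = \<omega>' z"
      using that(2,3) f_step[of z "\<omega>' z"] by simp
    with pos show ?thesis
      using fixed_point_unique[of z "\<omega> z" "\<omega>' z"] \<omega>[of z] that(3) by (simp add: upper_half_plane_def)
  qed
  moreover have "F1 w - w + z \<in> upper_half_plane \<and> f z w \<in> upper_half_plane"
    if z: "z \<in> upper_half_plane \<union> \<real>" and w: "w \<in> upper_half_plane" for z w
  proof -
    have "Im z \<ge> 0" "Im w > 0"
      using that by (auto simp: upper_half_plane_def complex_is_Real_iff)
    \<comment> \<open>For real \<open>z\<close> the strict sign comes from \<open>H1\<close>
      alone.\<close>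
    then have u: "Im (z + H1 w) > 0"
      using pos1[of w] by simp
    then have "Im (step z w) > 0"
      using pos2[OF u] \<open>Im z \<ge> 0\<close> by (simp add: step_def)
    then show ?thesis
      using u f_step[OF z \<open>Im w > 0\<close>] by (simp add: upper_half_plane_def H1_def algebra_simps)
  qed
  ultimately show ?thesis
    by blast
qed

end
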